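(* Let $I\subseteq\mathbb{R}$ be an interval with interior $I^\circ$, let $a,b\in I^\circ$ with $a<b$, and let $f:I\to\mathbb{R}$ be differentiable on $I^\circ$. Let $P: a=x_0<x_1<\dots<x_n=b$ be a partition of $[a,b]$, and let $g:[a,b]\to[0,\infty)$ be a differentiable function such that, for each $i\in\{0,\dots,n-1\}$, the restriction of $g$ to $[x_i,x_{i+1}]$ is symmetric to $\frac{x_i+x_{i+1}}{2}$. Let $h:[0,1]\to[0,\infty)$ be a (measurable) function with $h\not\equiv0$, and suppose that for each $i\in\{0,\dots,n-1\}$ the function $|f'|$ is $h$-convex on $[x_i,x_{i+1}]$. Then $$|E(f,g,P)|\leq\sum_{i=0}^{n-1}(x_{i+1}-x_i)\Big[|f'(x_i)|+|f'(x_{i+1})|\Big]\int_{\frac{x_i+x_{i+1}}{2}}^{x_{i+1}}\int_0^{\frac{x_{i+1}-x}{x_{i+1}-x_i}}g(x)\big[h(t)+h(1-t)\big]\,dt\,dx.$$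
   Context: A function $g$ on $[c,d]$ is symmetric to $\frac{c+d}{2}$ if $g(x)=g(c+d-x)$ for all $x\in[c,d]$. Let $h:[0,1]\to[0,\infty)$ with $h\not\equiv 0$. A nonnegative function $\varphi:J\to[0,\infty)$ on an interval $J$ is $h$-convex if for all $x,y\in J$ and all $\lambda\in[0,1]$, $\varphi(\lambda x+(1-\lambda)y)\le h(\lambda)\varphi(x)+h(1-\lambda)\varphi(y)$. The trapezoidal form and the associated approximation error are $$T(f,g,P)=\sum_{i=0}^{n-1}\frac{f(x_i)+f(x_{i+1})}{2}\int_{x_i}^{x_{i+1}}g(x)\,dx,\qquad E(f,g,P)=\int_a^b f(x)g(x)\,dx-T(f,g,P).$$ The double integrals on the right-hand side have nonnegative integrands and are understood as elements of $[0,\infty]$ (with $0\cdot\infty=0$). *)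

theory Defs
  imports "HOL-Analysis.Analysis"
begin

definition symmetric_on_interval :: "real \<Rightarrow> real \<Rightarrow> (real \<Rightarrow> real) \<Rightarrow> bool" where
  "symmetric_on_interval c d g \<longleftrightarrow> (\<forall>x\<in>{c..d}. g x = g (c + d - x))"

definition h_convex_on :: "(real \<Rightarrow> real) \<Rightarrow> real set \<Rightarrow> (real \<Rightarrow> real) \<Rightarrow> bool" where
  "h_convex_on h J \<phi> \<longleftrightarrow>
     is_interval J \<and> (\<forall>x\<in>J. 0 \<le> \<phi> x) \<and>
     (\<forall>x\<in>J. \<forall>y\<in>J. \<forall>t\<in>{0..1}.
        \<phi> (t * x + (1 - t) * y) \<le> h t * \<phi> x + h (1 - t) * \<phi> y)"

text \<open>A partition \<open>P\<close> of \<open>[a,b]\<close> is given by its number \<open>n\<close> of subintervals and its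
  points \<open>x 0\<close>, ..., \<open>x n\<close>; values of \<open>x\<close> beyond index \<open>n\<close> are irrelevant.\<close>

definition partition_of :: "real \<Rightarrow> real \<Rightarrow> nat \<Rightarrow> (nat \<Rightarrow> real) \<Rightarrow> bool" where
  "partition_of a b n x \<longleftrightarrow> x 0 = a \<and> x n = b \<and> (\<forall>i<n. x i < x (Suc i))"

definition trapezoidal_form ::
  "(real \<Rightarrow> real) \<Rightarrow> (real \<Rightarrow> real) \<Rightarrow> nat \<Rightarrow> (nat \<Rightarrow> real) \<Rightarrow> real" where
  "trapezoidal_form f g n x =
     (\<Sum>i<n. (f (x i) + f (x (Suc i))) / 2 * integral {x i..x (Suc i)} g)"

definition approx_error ::
  "(real \<Rightarrow> real) \<Rightarrow> (real \<Rightarrow> real) \<Rightarrow> nat \<Rightarrow> (nat \<Rightarrow> real) \<Rightarrow> real" where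
  "approx_error f g n x =
     integral {x 0..x n} (\<lambda>u. f u * g u) - trapezoidal_form f g n x"

end

theory Submission
  imports Defs
begin

text \<open>
  On a single subinterval \<open>[c,d]\<close> the error is the integral of
  \<open>(f u - (f c + f d) / 2) * g u\<close>. Since \<open>g\<close> is symmetric, folding this integral at the midpoint
  leaves the integral over the right half of \<open>g u * (f u + f (c + d - u) - f c - f d)\<close>
  (\<open>trapezoid_error_eq\<close>). The bracket is the increment of the symmetric combination
  \<open>t \<mapsto> f (d - t (d - c)) + f (c + t (d - c))\<close> between \<open>t = 0\<close> and \<open>t = (d - u) / (d - c)\<close>.
  Applying \<open>h\<close>-convexity of \<open>\<bar>f'\<bar>\<close> at the two mirrored points bounds the
  derivative of that combination by
  \<open>(d - c) (\<bar>f' c\<bar> + \<bar>f' d\<bar>) (h t + h (1 - t))\<close>, so integrating it, with the weight \<open>g u\<close>, gives the inner integral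
  of the claim (\<open>symmetric_pair_bound\<close>). Integrating over \<open>u\<close> and summing over the partition
  finishes the proof.

  The delicate point is integrability, since \<open>f'\<close> is an arbitrary derivative and \<open>h\<close> may have
  infinite integral. If the inner integral of the dominating function is infinite, the bound on the
  increment is trivial. If it is finite, that function is Lebesgue integrable, and its integral can
  be compared with the Henstock--Kurzweil integral of the derivative, which always exists and equals
  the increment (\<open>increment_le_nn_integral\<close>).
\<close>

section \<open>Integration lemmas\<close>

text \<open>
  Every simple function below \<open>c * F\<close> is \<open>c\<close> times a simple function below \<open>F\<close>, so the argument
  works for an arbitrary \<open>F\<close>. It moves constants out of the outer integral below, whose integrand is
  itself an integral depending on a parameter.
\<close>

lemma nn_integral_cmult_le:
  assumes "0 \<le> c"
  shows "(\<integral>\<^sup>+x. ennreal c * F x \<partial>M) \<le> ennreal c * (\<integral>\<^sup>+x. F x \<partial>M)"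
proof (cases "c = 0")
  case False
  with assms have c: "0 < c" by simp
  have inv: "ennreal c * (ennreal (1 / c) * y) = y" "ennreal (1 / c) * (ennreal c * y) = y" for y
    using c by (simp_all add: mult.assoc[symmetric] ennreal_mult[symmetric])
  show ?thesis
    unfolding nn_integral_def[of M "\<lambda>x. ennreal c * F x"]
  proof (rule SUP_least, clarify)
    fix s assume s: "simple_function M s" "s \<le> (\<lambda>x. ennreal c * F x)"
    have [measurable]: "s \<in> borel_measurable M"
      using s(1) by (rule borel_measurable_simple_function)
    have le: "ennreal (1 / c) * s x \<le> F x" for x
      using mult_left_mono[OF le_funD[OF s(2), of x], of "ennreal (1 / c)"] inv by simp
    have "integral\<^sup>S M s = (\<integral>\<^sup>+x. ennreal c * (ennreal (1 / c) * s x) \<partial>M)"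
      using s(1) by (simp add: inv nn_integral_eq_simple_integral)
    also have "\<dots> = ennreal c * (\<integral>\<^sup>+x. ennreal (1 / c) * s x \<partial>M)"
      by (rule nn_integral_cmult) measurable
    also have "\<dots> \<le> ennreal c * (\<integral>\<^sup>+x. F x \<partial>M)"
      by (intro mult_left_mono nn_integral_mono le) auto
    finally show "integral\<^sup>S M s \<le> ennreal c * (\<integral>\<^sup>+x. F x \<partial>M)" .
  qed
qed simp

text \<open>
  If the right-hand side is finite, \<open>H\<close> is integrable, and Henstock--Kurzweil integrals are
  compared: for them the fundamental theorem of calculus holds for every derivative.
\<close>

lemma increment_le_nn_integral:
  fixes k k' H :: "real \<Rightarrow> real"
  assumes "p \<le> q"
    and deriv: "\<And>t. t \<in> {p..q} \<Longrightarrow> (k has_real_derivative k' t) (at t within {p..q})"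
    and bound: "\<And>t. t \<in> {p..q} \<Longrightarrow> \<bar>k' t\<bar> \<le> H t"
    and meas: "H \<in> borel_measurable (lebesgue_on {p..q})"
  shows "ennreal \<bar>k q - k p\<bar> \<le> (\<integral>\<^sup>+t\<in>{p..q}. ennreal (H t) \<partial>lebesgue)"
proof (cases "(\<integral>\<^sup>+t\<in>{p..q}. ennreal (H t) \<partial>lebesgue) = \<infinity>")
  case False
  have nonneg: "0 \<le> H t" if "t \<in> {p..q}" for t
    using bound[OF that] by linarith
  have eq: "(\<integral>\<^sup>+t\<in>{p..q}. ennreal (H t) \<partial>lebesgue) = (\<integral>\<^sup>+t. ennreal (H t) \<partial>lebesgue_on {p..q})"
    by (simp add: nn_integral_restrict_space)
  have "(\<integral>\<^sup>+t. ennreal (norm (H t)) \<partial>lebesgue_on {p..q}) = (\<integral>\<^sup>+t. ennreal (H t) \<partial>lebesgue_on {p..q})"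
    by (rule nn_integral_cong) (auto simp: space_restrict_space nonneg)
  with False have "integrable (lebesgue_on {p..q}) H"
    by (intro integrableI_bounded meas) (simp add: eq less_top)
  then have H: "H integrable_on {p..q}"
    by (rule integrable_on_lebesgue_on) simp
  have k': "(k' has_integral (k q - k p)) {p..q}"
    using deriv by (intro fundamental_theorem_of_calculus \<open>p \<le> q\<close>)
      (simp add: has_real_derivative_iff_has_vector_derivative)
  have "\<bar>k q - k p\<bar> \<le> integral {p..q} H"
    using integral_norm_bound_integral[OF has_integral_integrable[OF k'] H] bound
    by (simp add: integral_unique[OF k'])
  then have "ennreal \<bar>k q - k p\<bar> \<le> ennreal (integral {p..q} H)"
    by (rule ennreal_leI)
  also have "\<dots> = (\<integral>\<^sup>+t\<in>{p..q}. ennreal (H t) \<partial>lborel)"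
    using nn_integral_has_integral_lebesgue'[OF nonneg integrable_integral[OF H]] by simp
  also have "\<dots> = (\<integral>\<^sup>+t\<in>{p..q}. ennreal (H t) \<partial>lebesgue)"
    by (simp add: nn_integral_completion)
  finally show ?thesis .
qed simp

lemma borel_measurable_plus_reflection:
  fixes h :: "real \<Rightarrow> real"
  assumes "h \<in> borel_measurable (lebesgue_on {0..1})"
  shows "(\<lambda>t. h t + h (1 - t)) \<in> borel_measurable (lebesgue_on {0..1})"
proof -
  have "(\<lambda>t. 1 - t) \<in> lebesgue_on {0..1::real} \<rightarrow>\<^sub>M lebesgue_on {0..1}"
  proof (rule measurable_restrict_space3)
    show "(\<lambda>t::real. 1 - t) \<in> lebesgue \<rightarrow>\<^sub>M lebesgue"
      using lebesgue_affine_measurable[of "\<lambda>_. -1" "1::real"] by simp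
  qed auto
  from measurable_compose[OF this assms] assms show ?thesis
    by (intro borel_measurable_add) (simp_all add: o_def)
qed

section \<open>The error on one subinterval\<close>

text \<open>
  The points \<open>d - t (d - c)\<close> and \<open>c + t (d - c)\<close> are the convex combinations of \<open>c\<close> and \<open>d\<close> with
  the weights \<open>t\<close> and \<open>1 - t\<close> interchanged, which is why the sum factorises.
\<close>

lemma h_convex_pair_le:
  assumes conv: "h_convex_on h {c..d} \<phi>" and "c < d" and t: "t \<in> {0..1}"
  shows "\<phi> (d - t * (d - c)) + \<phi> (c + t * (d - c)) \<le> (\<phi> c + \<phi> d) * (h t + h (1 - t))"
proof -
  have "\<phi> (t * c + (1 - t) * d) \<le> h t * \<phi> c + h (1 - t) * \<phi> d"
       "\<phi> (t * d + (1 - t) * c) \<le> h t * \<phi> d + h (1 - t) * \<phi> c"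
    using conv \<open>c < d\<close> t unfolding h_convex_on_def by auto
  moreover have "t * c + (1 - t) * d = d - t * (d - c)" "t * d + (1 - t) * c = c + t * (d - c)"
    by (simp_all add: algebra_simps)
  ultimately show ?thesis by (simp add: algebra_simps)
qed

text \<open>
  The weight \<open>w\<close>, which will be \<open>g u\<close>, is carried inside the integral because there it
  appears in the final estimate; this also covers \<open>w = 0\<close> with a divergent integral of \<open>h\<close>.
\<close>

lemma symmetric_pair_bound:
  fixes f f' h :: "real \<Rightarrow> real"
  assumes "c < d"
    and deriv: "\<And>u. u \<in> {c..d} \<Longrightarrow> (f has_real_derivative f' u) (at u within {c..d})"
    and conv: "h_convex_on h {c..d} (\<lambda>u. \<bar>f' u\<bar>)"
    and meas: "h \<in> borel_measurable (lebesgue_on {0..1})"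
    and u: "u \<in> {c..d}" and "0 \<le> w"
  shows "ennreal (w * \<bar>f u + f (c + d - u) - f c - f d\<bar>) \<le>
    ennreal ((d - c) * (\<bar>f' c\<bar> + \<bar>f' d\<bar>)) *
      (\<integral>\<^sup>+t\<in>{0..(d - u) / (d - c)}. ennreal (w * (h t + h (1 - t))) \<partial>lebesgue)"
proof -
  define L where "L = d - c"
  define \<tau> where "\<tau> = (d - u) / L"
  define K where "K = L * (\<bar>f' c\<bar> + \<bar>f' d\<bar>)"
  define k where "k t = w * (f (d - t * L) + f (c + t * L))" for t
  have L: "0 < L" using \<open>c < d\<close> by (simp add: L_def)
  have K: "0 \<le> K" using L by (simp add: K_def)
  have \<tau>: "0 \<le> \<tau>" "\<tau> \<le> 1" "\<tau> * L = d - u"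
    using L u by (auto simp: \<tau>_def L_def divide_simps)
  have in_cd: "d - t * L \<in> {c..d}" "c + t * L \<in> {c..d}" if "t \<in> {0..\<tau>}" for t
  proof -
    have "0 \<le> t * L" "t * L \<le> 1 * L"
      using that \<tau> L by (auto intro!: mult_right_mono mult_nonneg_nonneg simp del: mult_1)
    then show "d - t * L \<in> {c..d}" "c + t * L \<in> {c..d}" by (auto simp: L_def)
  qed
  have k_deriv: "(k has_real_derivative w * (f' (d - t * L) * - L + f' (c + t * L) * L))
      (at t within {0..\<tau>})" if "t \<in> {0..\<tau>}" for t
  proof -
    have "((f \<circ> (\<lambda>t. d - t * L)) has_real_derivative f' (d - t * L) * - L) (at t within {0..\<tau>})"
      by (rule DERIV_image_chain, rule DERIV_subset[OF deriv])
        (use in_cd that in \<open>auto intro!: derivative_eq_intros\<close>)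
    moreover have "((f \<circ> (\<lambda>t. c + t * L)) has_real_derivative f' (c + t * L) * L) (at t within {0..\<tau>})"
      by (rule DERIV_image_chain, rule DERIV_subset[OF deriv])
        (use in_cd that in \<open>auto intro!: derivative_eq_intros\<close>)
    ultimately show ?thesis
      unfolding k_def o_def by (intro DERIV_cmult DERIV_add)
  qed
  have k_bound: "\<bar>w * (f' (d - t * L) * - L + f' (c + t * L) * L)\<bar> \<le> K * (w * (h t + h (1 - t)))"
    if "t \<in> {0..\<tau>}" for t
  proof -
    have "\<bar>w * (f' (d - t * L) * - L + f' (c + t * L) * L)\<bar>
        = \<bar>(w * L) * (f' (c + t * L) - f' (d - t * L))\<bar>"
      by (rule arg_cong[of _ _ abs]) (simp add: algebra_simps)
    also have "\<dots> = w * L * \<bar>f' (c + t * L) - f' (d - t * L)\<bar>"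
      using L \<open>0 \<le> w\<close> by (simp add: abs_mult)
    also have "\<dots> \<le> w * L * ((\<bar>f' c\<bar> + \<bar>f' d\<bar>) * (h t + h (1 - t)))"
      using h_convex_pair_le[OF conv \<open>c < d\<close>, of t] that \<tau> L \<open>0 \<le> w\<close>
      by (intro mult_left_mono) (auto simp: L_def[symmetric])
    finally show ?thesis by (simp add: K_def ac_simps)
  qed
  have "(\<lambda>t. h t + h (1 - t)) \<in> borel_measurable (lebesgue_on {0..\<tau>})"
    using measurable_restrict_mono[OF borel_measurable_plus_reflection[OF meas]] \<tau> by auto
  then have "(\<lambda>t. K * (w * (h t + h (1 - t)))) \<in> borel_measurable (lebesgue_on {0..\<tau>})"
    by (intro borel_measurable_times borel_measurable_const)
  from increment_le_nn_integral[OF \<tau>(1) k_deriv k_bound this]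
  have "ennreal \<bar>k \<tau> - k 0\<bar> \<le> (\<integral>\<^sup>+t\<in>{0..\<tau>}. ennreal (K * (w * (h t + h (1 - t)))) \<partial>lebesgue)"
    by simp
  also have "\<dots> = (\<integral>\<^sup>+t. ennreal K * (ennreal (w * (h t + h (1 - t))) * indicator {0..\<tau>} t) \<partial>lebesgue)"
    using K by (simp add: ennreal_mult' mult.assoc)
  also have "\<dots> \<le> ennreal K * (\<integral>\<^sup>+t\<in>{0..\<tau>}. ennreal (w * (h t + h (1 - t))) \<partial>lebesgue)"
    using K by (rule nn_integral_cmult_le)
  also have "k \<tau> - k 0 = w * (f u + f (c + d - u) - f c - f d)"
  proof -
    have "d - \<tau> * L = u" "c + \<tau> * L = c + d - u" using \<tau>(3) by auto
    then show ?thesis unfolding k_def by (simp add: algebra_simps)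
  qed
  finally show ?thesis
    using \<open>0 \<le> w\<close> by (simp add: abs_mult K_def L_def \<tau>_def)
qed

lemma integral_fold_midpoint:
  fixes v :: "real \<Rightarrow> real"
  assumes "c \<le> d" and cont: "continuous_on {c..d} v"
  shows "((\<lambda>u. v u + v (c + d - u)) has_integral integral {c..d} v) {(c + d) / 2..d}"
proof -
  define m where "m = (c + d) / 2"
  have m: "c \<le> m" "m \<le> d" and m_fixed: "c + d - m = m" using assms by (auto simp: m_def field_simps)
  have int: "v integrable_on {c..d}" using cont by (rule integrable_continuous_real)
  have left: "(v has_integral integral {c..m} v) {c..m}"
    and right: "(v has_integral integral {m..d} v) {m..d}"
    using int m by (auto intro!: integrable_integral intro: integrable_subinterval_real)
  have "(\<lambda>u. c + d - u) ` {c..m} = {m..d}"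
    by (simp add: image_diff_atLeastAtMost m_fixed)
  with has_integral_affinity[of v "integral {c..m} v" c m "-1" "c + d"] left
  have "((\<lambda>u. v (c + d - u)) has_integral integral {c..m} v) {m..d}"
    by (simp add: m_fixed add.commute[of d c])
  from has_integral_add[OF right this] show ?thesis
    using Henstock_Kurzweil_Integration.integral_combine[OF m(1,2) int] by (simp add: m_def add.commute)
qed

lemma trapezoid_error_eq:
  fixes f g :: "real \<Rightarrow> real"
  assumes "c \<le> d" and f: "continuous_on {c..d} f" and g: "continuous_on {c..d} g"
    and sym: "symmetric_on_interval c d g"
  shows "((\<lambda>u. g u * (f u + f (c + d - u) - f c - f d)) has_integral
    integral {c..d} (\<lambda>u. f u * g u) - (f c + f d) / 2 * integral {c..d} g) {(c + d) / 2..d}"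
proof -
  define v where "v u = f u * g u - (f c + f d) / 2 * g u" for u
  have cont: "continuous_on {c..d} v"
    unfolding v_def by (intro continuous_intros f g)
  have eq: "integral {c..d} v = integral {c..d} (\<lambda>u. f u * g u) - (f c + f d) / 2 * integral {c..d} g"
    unfolding v_def
    by (simp add: integral_diff integrable_continuous_real continuous_on_mult
        continuous_on_mult_const f g)
  show ?thesis
    unfolding eq[symmetric]
  proof (rule has_integral_eq[OF _ integral_fold_midpoint[OF \<open>c \<le> d\<close> cont]])
    fix u assume "u \<in> {(c + d) / 2..d}"
    with \<open>c \<le> d\<close> have "u \<in> {c..d}" by auto
    with sym have "g u = g (c + d - u)"
      unfolding symmetric_on_interval_def by blast
    then show "v u + v (c + d - u) = g u * (f u + f (c + d - u) - f c - f d)"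
      by (simp add: v_def algebra_simps)
  qed
qed

lemma trapezoid_error_bound:
  fixes f f' g h :: "real \<Rightarrow> real"
  assumes "c < d"
    and deriv: "\<And>u. u \<in> {c..d} \<Longrightarrow> (f has_real_derivative f' u) (at u within {c..d})"
    and g: "continuous_on {c..d} g" and g_nonneg: "\<And>u. u \<in> {c..d} \<Longrightarrow> 0 \<le> g u"
    and sym: "symmetric_on_interval c d g"
    and conv: "h_convex_on h {c..d} (\<lambda>u. \<bar>f' u\<bar>)"
    and meas: "h \<in> borel_measurable (lebesgue_on {0..1})"
  shows "ennreal \<bar>integral {c..d} (\<lambda>u. f u * g u) - (f c + f d) / 2 * integral {c..d} g\<bar> \<le>
    ennreal ((d - c) * (\<bar>f' c\<bar> + \<bar>f' d\<bar>)) *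
      (\<integral>\<^sup>+u\<in>{(c + d) / 2..d}.
        (\<integral>\<^sup>+t\<in>{0..(d - u) / (d - c)}. ennreal (g u * (h t + h (1 - t))) \<partial>lebesgue) \<partial>lebesgue)"
    (is "ennreal \<bar>?E\<bar> \<le> ennreal ?K * _")
proof -
  define G where "G u = f u + f (c + d - u) - f c - f d" for u
  define inner where
    "inner u = (\<integral>\<^sup>+t\<in>{0..(d - u) / (d - c)}. ennreal (g u * (h t + h (1 - t))) \<partial>lebesgue)" for u
  let ?J = "{(c + d) / 2..d}"
  have J: "?J \<subseteq> {c..d}" using \<open>c < d\<close> by auto
  have f: "continuous_on {c..d} f"
    using deriv by (rule DERIV_continuous_on)
  have E: "((\<lambda>u. g u * G u) has_integral ?E) ?J"
    unfolding G_def using \<open>c < d\<close> f g sym by (intro trapezoid_error_eq) auto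
  have "continuous_on ?J (\<lambda>u. g u * \<bar>G u\<bar>)"
    unfolding G_def
    by (intro continuous_intros continuous_on_subset[OF g J] continuous_on_subset[OF f J]
        continuous_on_compose2[OF f]) (use \<open>c < d\<close> in auto)
  then have int: "(\<lambda>u. g u * \<bar>G u\<bar>) integrable_on ?J"
    by (rule integrable_continuous_real)
  have "\<bar>?E\<bar> \<le> integral ?J (\<lambda>u. g u * \<bar>G u\<bar>)"
    using integral_norm_bound_integral[OF has_integral_integrable[OF E] int] J g_nonneg
    by (auto simp: integral_unique[OF E] abs_mult subset_eq)
  then have "ennreal \<bar>?E\<bar> \<le> ennreal (integral ?J (\<lambda>u. g u * \<bar>G u\<bar>))"
    by (rule ennreal_leI)
  also have "\<dots> = (\<integral>\<^sup>+u\<in>?J. ennreal (g u * \<bar>G u\<bar>) \<partial>lborel)"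
    by (rule nn_integral_has_integral_lebesgue'[symmetric, OF _ integrable_integral[OF int]])
      (use J g_nonneg in auto)
  also have "\<dots> = (\<integral>\<^sup>+u\<in>?J. ennreal (g u * \<bar>G u\<bar>) \<partial>lebesgue)"
    by (simp add: nn_integral_completion)
  also have "\<dots> \<le> (\<integral>\<^sup>+u. ennreal ?K * (inner u * indicator ?J u) \<partial>lebesgue)"
  proof (rule nn_integral_mono)
    fix u
    show "ennreal (g u * \<bar>G u\<bar>) * indicator ?J u \<le> ennreal ?K * (inner u * indicator ?J u)"
    proof (cases "u \<in> ?J")
      case True
      with J have u: "u \<in> {c..d}" by auto
      from symmetric_pair_bound[OF \<open>c < d\<close> deriv conv meas u g_nonneg[OF u]] True
      show ?thesis by (simp add: inner_def G_def)
    qed simp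
  qed
  also have "\<dots> \<le> ennreal ?K * (\<integral>\<^sup>+u\<in>?J. inner u \<partial>lebesgue)"
    using \<open>c < d\<close> by (intro nn_integral_cmult_le) auto
  finally show ?thesis by (simp add: inner_def)
qed

section \<open>Summation over the partition\<close>

lemma partition_of_mono:
  assumes "partition_of a b n x" and "i \<le> j" and "j \<le> n"
  shows "x i \<le> x j"
  using \<open>i \<le> j\<close> \<open>j \<le> n\<close>
proof (induction j rule: dec_induct)
  case (step k)
  have "x i \<le> x k"
    using step.IH step.prems by (metis Suc_leD)
  also have "x k \<le> x (Suc k)"
    using assms(1) step.prems unfolding partition_of_def
    by (metis Suc_le_lessD order_less_imp_le)
  finally show ?case .
next
  case base
  show ?case by (rule order_refl)
qed

lemma integral_partition:
  fixes v :: "real \<Rightarrow> real"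
  assumes P: "partition_of a b n x" and v: "continuous_on {a..b} v"
  shows "integral {a..b} v = (\<Sum>i<n. integral {x i..x (Suc i)} v)"
proof -
  have "integral {x 0..x m} v = (\<Sum>i<m. integral {x i..x (Suc i)} v)" if "m \<le> n" for m
    using that
  proof (induction m)
    case (Suc m)
    have le: "x 0 \<le> x m" "x m \<le> x (Suc m)" "x (Suc m) \<le> x n"
      using partition_of_mono[OF P] Suc.prems by auto
    have "v integrable_on {x 0..x (Suc m)}"
      using P le by (intro integrable_continuous_real continuous_on_subset[OF v])
        (auto simp: partition_of_def)
    from Henstock_Kurzweil_Integration.integral_combine[OF le(1,2) this] Suc
    show ?case by simp
  qed simp
  from this[of n] P show ?thesis by (simp add: partition_of_def)
qed

theorem mainTheorem6:
  fixes I :: "real set" and a b :: real and f g h :: "real \<Rightarrow> real"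
    and n :: nat and x :: "nat \<Rightarrow> real"
  assumes "is_interval I"
    and "a \<in> interior I" and "b \<in> interior I" and "a < b"
    and "f differentiable_on interior I"
    and "partition_of a b n x"
    and "g differentiable_on {a..b}"
    and "\<And>u. u \<in> {a..b} \<Longrightarrow> 0 \<le> g u"
    and "\<And>i. i < n \<Longrightarrow> symmetric_on_interval (x i) (x (Suc i)) g"
    and "\<And>t. t \<in> {0..1} \<Longrightarrow> 0 \<le> h t"
    and "\<exists>t\<in>{0..1}. h t \<noteq> 0"
    and "h \<in> borel_measurable (lebesgue_on {0..1})"
    and "\<And>i. i < n \<Longrightarrow> h_convex_on h {x i..x (Suc i)} (\<lambda>u. \<bar>deriv f u\<bar>)"
  shows "ennreal \<bar>approx_error f g n x\<bar> \<le>
    (\<Sum>i<n. ennreal ((x (Suc i) - x i) * (\<bar>deriv f (x i)\<bar> + \<bar>deriv f (x (Suc i))\<bar>)) *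
      (\<integral>\<^sup>+u\<in>{(x i + x (Suc i)) / 2..x (Suc i)}.
        (\<integral>\<^sup>+t\<in>{0..(x (Suc i) - u) / (x (Suc i) - x i)}.
          ennreal (g u * (h t + h (1 - t))) \<partial>lebesgue) \<partial>lebesgue))"
proof -
  have P: "partition_of a b n x" by (rule assms(6))
  have ab: "{a..b} \<subseteq> interior I"
  proof -
    have "is_interval (interior I)"
      using \<open>is_interval I\<close> by (simp add: is_interval_convex_1 convex_interior)
    from interval_subset_is_interval[OF this, of a b] assms(2,3) show ?thesis
      by simp
  qed
  have deriv: "(f has_real_derivative deriv f u) (at u)" if "u \<in> {a..b}" for u
  proof -
    from that ab have u: "u \<in> interior I" by blast
    with assms(5) have "f differentiable (at u within interior I)"
      by (simp add: differentiable_on_def)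
    then have "f differentiable (at u)"
      by (simp only: at_within_open[OF u open_interior])
    then show ?thesis by (simp add: DERIV_deriv_iff_real_differentiable)
  qed
  have f: "continuous_on {a..b} f"
    by (rule DERIV_continuous_on, rule has_field_derivative_at_within, rule deriv)
  have g: "continuous_on {a..b} g"
    using assms(7) by (rule differentiable_imp_continuous_on)
  have sub: "{x i..x (Suc i)} \<subseteq> {a..b}" if "i < n" for i
  proof -
    have "x 0 \<le> x i" "x (Suc i) \<le> x n"
      using that by (auto intro: partition_of_mono[OF P])
    moreover have "x 0 = a" "x n = b"
      using P by (simp_all add: partition_of_def)
    ultimately show ?thesis by auto
  qed
  have "\<bar>approx_error f g n x\<bar> = \<bar>\<Sum>i<n. integral {x i..x (Suc i)} (\<lambda>u. f u * g u)
      - (f (x i) + f (x (Suc i))) / 2 * integral {x i..x (Suc i)} g\<bar>"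
    using integral_partition[OF P, of "\<lambda>u. f u * g u"] P f g
    by (simp add: approx_error_def trapezoidal_form_def partition_of_def continuous_on_mult
        sum_subtractf)
  also have "\<dots> \<le> (\<Sum>i<n. \<bar>integral {x i..x (Suc i)} (\<lambda>u. f u * g u)
      - (f (x i) + f (x (Suc i))) / 2 * integral {x i..x (Suc i)} g\<bar>)"
    by (rule sum_abs)
  finally have "ennreal \<bar>approx_error f g n x\<bar> \<le>
      (\<Sum>i<n. ennreal \<bar>integral {x i..x (Suc i)} (\<lambda>u. f u * g u)
      - (f (x i) + f (x (Suc i))) / 2 * integral {x i..x (Suc i)} g\<bar>)"
    by (subst sum_ennreal) (auto intro: ennreal_leI)
  also have "\<dots> \<le> (\<Sum>i<n. ennreal ((x (Suc i) - x i) * (\<bar>deriv f (x i)\<bar> + \<bar>deriv f (x (Suc i))\<bar>)) *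
      (\<integral>\<^sup>+u\<in>{(x i + x (Suc i)) / 2..x (Suc i)}.
        (\<integral>\<^sup>+t\<in>{0..(x (Suc i) - u) / (x (Suc i) - x i)}.
          ennreal (g u * (h t + h (1 - t))) \<partial>lebesgue) \<partial>lebesgue))"
  proof (intro sum_mono trapezoid_error_bound)
    fix i assume "i \<in> {..<n}"
    then have i: "i < n" by simp
    show "x i < x (Suc i)" using P i by (simp add: partition_of_def)
    show "continuous_on {x i..x (Suc i)} g"
      using g sub[OF i] by (rule continuous_on_subset)
    show "(f has_real_derivative deriv f u) (at u within {x i..x (Suc i)})"
      if "u \<in> {x i..x (Suc i)}" for u
      by (rule has_field_derivative_at_within, rule deriv) (use sub[OF i] that in blast)
    show "0 \<le> g u" if "u \<in> {x i..x (Suc i)}" for u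
      using assms(8) sub[OF i] that by blast
  qed (use assms(9,12,13) in simp_all)
  finally show ?thesis .
qed

end
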